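(* Let $f:\mathbb{N}\to\mathbb{N}$ be nondecreasing and let $\mathcal{C}$ be a hereditary class of graphs with balanced separators of size at most $f(n)$. Then for every integer $n\ge 1$, the class $\mathcal{C}_n$ of $n$-vertex graphs in $\mathcal{C}$ has an isometric-universal graph with at most $2^{O(f(n)\cdot\log^2 n)}$ vertices.
   Context: A class is hereditary if it is closed under taking induced subgraphs. In an $n$-vertex graph $G$, a vertex set $S$ is a balanced separator if $V(G)\setminus S$ can be partitioned into two sets $X,Y$, each of size at most $2n/3$, with no edge between $X$ and $Y$. $\mathcal{C}$ has balanced separators of size at most $f(n)$ if for every $n\ge1$ every $n$-vertex graph of $\mathcal{C}$ has a balanced separator of size at most $f(n)$. A subgraph $G$ of $H$ is isometric if $d_G(u,v)=d_H(u,v)$ for all $u,v\in V(G)$; $H$ is isometric-universal for a class if it contains an isometric copy of each graph of the class. $\log$ is the binary logarithm. *)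

theory Defs
  imports
    "Graph_Theory.Graph_Theory"
    "HOL-Analysis.Analysis"
begin

text \<open>
  A finite simple graph is a \<open>pair_graph\<close>: a finite, loop-free, symmetric relation on its
  vertices, each edge \<open>{u, v}\<close> being represented by the two arcs \<open>(u, v)\<close> and \<open>(v, u)\<close>.
  Graph classes are sets of graphs on natural numbers, which represent every finite graph up to
  isomorphism. Classes need not be closed under isomorphism; an isomorphism-closed class is a
  special case.
\<close>

type_synonym ngraph = "nat pair_pre_digraph"

definition graph_class :: "ngraph set \<Rightarrow> bool" where
  "graph_class C \<longleftrightarrow> (\<forall>G\<in>C. pair_graph G)"

definition hereditary :: "ngraph set \<Rightarrow> bool" where
  "hereditary C \<longleftrightarrow> (\<forall>G\<in>C. \<forall>H :: ngraph. induced_subgraph (with_proj H) (with_proj G) \<longrightarrow> H \<in> C)"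

definition graphs_of_order :: "ngraph set \<Rightarrow> nat \<Rightarrow> ngraph set" where
  "graphs_of_order C n = {G \<in> C. card (pverts G) = n}"

text \<open>The sides \<open>X\<close> and \<open>Y\<close> may be empty: a one-vertex graph has no other balanced
  separator than its whole vertex set.\<close>

definition balanced_separator :: "'a pair_pre_digraph \<Rightarrow> 'a set \<Rightarrow> bool" where
  "balanced_separator G S \<longleftrightarrow>
     S \<subseteq> pverts G \<and>
     (\<exists>X Y. X \<union> Y = pverts G - S \<and> X \<inter> Y = {} \<and>
        real (card X) \<le> 2 * real (card (pverts G)) / 3 \<and>
        real (card Y) \<le> 2 * real (card (pverts G)) / 3 \<and>
        (\<forall>x\<in>X. \<forall>y\<in>Y. (x, y) \<notin> parcs G))"

definition has_balanced_separators :: "ngraph set \<Rightarrow> (nat \<Rightarrow> nat) \<Rightarrow> bool" where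
  "has_balanced_separators C f \<longleftrightarrow>
     (\<forall>n\<ge>1. \<forall>G\<in>graphs_of_order C n. \<exists>S. balanced_separator G S \<and> card S \<le> f n)"

text \<open>The number of edges on a shortest path, and \<open>\<infinity>\<close> if there is no path.\<close>

definition graph_dist :: "'a pair_pre_digraph \<Rightarrow> 'a \<Rightarrow> 'a \<Rightarrow> ereal" where
  "graph_dist G u v = wf_digraph.\<mu> (with_proj G) (\<lambda>_. 1) u v"

definition isometric_subgraph :: "'a pair_pre_digraph \<Rightarrow> 'a pair_pre_digraph \<Rightarrow> bool" where
  "isometric_subgraph G H \<longleftrightarrow>
     subgraph (with_proj G) (with_proj H) \<and> (\<forall>u\<in>pverts G. \<forall>v\<in>pverts G. graph_dist G u v = graph_dist H u v)"

definition isometric_universal :: "'a pair_pre_digraph \<Rightarrow> 'b pair_pre_digraph set \<Rightarrow> bool" where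
  "isometric_universal H C \<longleftrightarrow>
     (\<forall>G\<in>C. \<exists>K. pair_graph K \<and> isometric_subgraph K H \<and> digraph_iso (with_proj G) (with_proj K))"

end

(* The graphs of the class are embedded into one graph of distance labels. Applying balanced
   separators recursively arranges the vertices of G in the nodes of a binary tree of logarithmic
   depth, at most f n of them in each node, such that adjacent vertices lie in comparable nodes.
   The label of v lists its node and its distances in G to all vertices in the nodes above. Two
   labels are adjacent when their nodes are comparable and their distances to the common separator
   vertices differ by at most one. Then every arc of G is an arc between labels, and conversely a
   walk of length k between the labels of u and v has a shallowest label, which is at distance zero
   from some common separator position; as that coordinate changes by at most one in each step,
   d(u, s) + d(s, v) is at most k for the vertex s of G at this position, even if the walk leaves
   the image of G. *)

theory Submission
  imports Defs
begin

section \<open>Distances and walks\<close>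

text \<open>Powers of the arc relation replace arc lists, since they split and join easily at a
  given length. The condition \<open>u \<in> pverts G\<close> matters for \<open>k = 0\<close>: the
  identity relation also contains pairs outside the graph.\<close>

lemma relpow_awalk:
  assumes "pair_wf_digraph G"
  shows "u \<in> pverts G \<and> (u, v) \<in> parcs G ^^ k \<longleftrightarrow>
    (\<exists>p. pre_digraph.awalk (with_proj G) u p v \<and> length p = k)"
proof -
  interpret pair_wf_digraph G by fact
  show ?thesis
  proof (induction k arbitrary: u)
    case 0
    then show ?case by (auto simp: awalk_Nil_iff)
  next
    case (Suc k)
    have "u \<in> pverts G \<and> (u, v) \<in> parcs G ^^ Suc k \<longleftrightarrow>
      (\<exists>w. (u, w) \<in> parcs G \<and> w \<in> pverts G \<and> (w, v) \<in> parcs G ^^ k)"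
      using in_arcsD1 in_arcsD2 relpow_Suc_I2[of u _ "parcs G" v k] relpow_Suc_D2[of u v k "parcs G"]
      by blast
    also have "\<dots> \<longleftrightarrow> (\<exists>w p. (u, w) \<in> parcs G \<and> awalk w p v \<and> length p = k)"
      using Suc.IH by blast
    also have "\<dots> \<longleftrightarrow> (\<exists>p. awalk u p v \<and> length p = Suc k)"
    proof
      assume "\<exists>w p. (u, w) \<in> parcs G \<and> awalk w p v \<and> length p = k"
      then obtain w p where "(u, w) \<in> parcs G" "awalk w p v" "length p = k"
        by blast
      then show "\<exists>p. awalk u p v \<and> length p = Suc k"
        by (intro exI[of _ "(u, w) # p"]) (simp add: awalk_Cons_iff)
    qed (fastforce simp: length_Suc_conv awalk_Cons_iff)
    finally show ?case .
  qed
qed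

lemma graph_dist_eq_INF:
  assumes "pair_wf_digraph G"
  shows "graph_dist G u v = (INF p\<in>{p. pre_digraph.awalk (with_proj G) u p v}. ereal (length p))"
proof -
  interpret pair_wf_digraph G by fact
  have "awalk_cost (\<lambda>_. 1) p = length p" for p
    by (induction p) auto
  then show ?thesis
    by (simp add: graph_dist_def \<mu>_def)
qed

lemma graph_dist_le:
  assumes "pair_wf_digraph G" "u \<in> pverts G" "(u, v) \<in> parcs G ^^ k"
  shows "graph_dist G u v \<le> ereal k"
proof -
  obtain p where "pre_digraph.awalk (with_proj G) u p v" "length p = k"
    using relpow_awalk[OF assms(1)] assms(2,3) by blast
  then show ?thesis
    unfolding graph_dist_eq_INF[OF assms(1)] by (auto intro!: INF_lower2)
qed

text \<open>Unit costs leave no negative cycle, so a finite distance is attained by a simple path,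
  which has fewer arcs than the graph has vertices. The bound on \<open>k\<close> later leaves only
  finitely many values for a label entry.\<close>

lemma graph_dist_cases:
  fixes G :: "'a pair_pre_digraph"
  assumes "pair_fin_digraph G"
  obtains "graph_dist G u v = \<infinity>"
  | k where "graph_dist G u v = ereal (real k)" "(u, v) \<in> parcs G ^^ k" "k < card (pverts G)"
proof -
  interpret pair_fin_digraph G by fact
  have wf: "pair_wf_digraph G" ..
  show thesis
  proof (cases "\<mu> (\<lambda>_. 1) u v < \<infinity>")
    case False
    then show thesis
      using that(1) by (simp add: graph_dist_def)
  next
    case True
    have cost: "awalk_cost (\<lambda>_. 1) p = length p" for p
      by (induction p) auto
    obtain p where p: "apath u p v" "\<mu> (\<lambda>_. 1) u v = awalk_cost (\<lambda>_. 1) p"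
      using no_neg_cyc_reach_imp_path[OF True[unfolded \<mu>_reach_conv], of "\<lambda>_. 1"] by (auto simp: cost)
    moreover have "(u, v) \<in> parcs G ^^ length p"
      using relpow_awalk[OF wf] awalkI_apath[OF p(1)] by blast
    ultimately show thesis
      using that(2)[of "length p"] length_apath_less[OF p(1)] by (simp add: graph_dist_def cost)
  qed
qed

lemma graph_dist_leD:
  assumes "pair_fin_digraph G" "graph_dist G u v \<le> ereal (real k)"
  obtains j where "j \<le> k" "(u, v) \<in> parcs G ^^ j"
  using assms(2) by (cases rule: graph_dist_cases[OF assms(1), of u v]) (auto intro: that)

text \<open>Lower bounds on a distance are reduced to statements about single walks; the infinite
  case is trivial. This is how walks of labels enter.\<close>

lemma le_graph_distI:
  assumes "pair_fin_digraph G" "\<And>k. (u, v) \<in> parcs G ^^ k \<Longrightarrow> x \<le> ereal (real k)"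
  shows "x \<le> graph_dist G u v"
  using assms(2) by (cases rule: graph_dist_cases[OF assms(1), of u v]) auto

lemma graph_dist_triangle:
  assumes "pair_fin_digraph G" "u \<in> pverts G"
    and "graph_dist G u v \<le> ereal (real i)" "graph_dist G v w \<le> ereal (real j)"
  shows "graph_dist G u w \<le> ereal (real (i + j))"
proof -
  obtain i' j' where *: "i' \<le> i" "(u, v) \<in> parcs G ^^ i'" "j' \<le> j" "(v, w) \<in> parcs G ^^ j'"
    using graph_dist_leD assms by metis
  then have "(u, w) \<in> parcs G ^^ (i' + j')"
    by (auto simp: relpow_add)
  then have "graph_dist G u w \<le> ereal (real (i' + j'))"
    using assms(1,2) by (intro graph_dist_le) (auto simp: pair_fin_digraph_def)
  also have "\<dots> \<le> ereal (real (i + j))"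
    using * by simp
  finally show ?thesis .
qed

section \<open>Distances in simple graphs: symmetry, zeros and change along an arc\<close>

lemma relpow_sym: "sym R \<Longrightarrow> (u, v) \<in> R ^^ k \<Longrightarrow> (v, u) \<in> R ^^ k"
  by (induction k arbitrary: v) (auto simp del: relpow.simps(2) elim!: relpow_Suc_E intro: relpow_Suc_I2 dest: symD)

lemma pair_graph_sym: "pair_graph G \<Longrightarrow> sym (parcs G)"
  using pair_sym_digraph.arcs_symmetric
  by (auto simp: sym_def pair_graph_def pair_pseudo_graph_def)

lemma pair_graph_irrefl: "pair_graph G \<Longrightarrow> (u, v) \<in> parcs G \<Longrightarrow> u \<noteq> v"
  using pair_loopfree_digraph.no_loops'[of G u v]
  by (simp add: pair_graph_def pair_digraph_def)

lemma pair_graph_fin: "pair_graph G \<Longrightarrow> pair_fin_digraph G"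
  by (simp add: pair_graph_def pair_digraph_def)

lemma pair_graph_wf: "pair_graph G \<Longrightarrow> pair_wf_digraph G"
  by (simp add: pair_graph_fin pair_fin_digraph.axioms(1))

lemma pair_graphI:
  assumes "finite (pverts G)" "parcs G \<subseteq> pverts G \<times> pverts G" "sym (parcs G)" "irrefl (parcs G)"
  shows "pair_graph G"
proof
  show "finite (parcs G)"
    using assms(1,2) by (meson finite_SigmaI finite_subset)
qed (use assms in \<open>auto simp: symmetric_def irrefl_def\<close>)

lemma graph_dist_sym:
  assumes "pair_graph G" "u \<in> pverts G" "v \<in> pverts G"
  shows "graph_dist G u v = graph_dist G v u"
proof -
  have "graph_dist G u v \<le> graph_dist G v u" if "u \<in> pverts G" for u v
    using graph_dist_le[OF pair_graph_wf[OF assms(1)] that] relpow_sym[OF pair_graph_sym[OF assms(1)]]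
    by (intro le_graph_distI[OF pair_graph_fin[OF assms(1)]]) blast
  with assms(2,3) show ?thesis by (metis antisym)
qed

lemma graph_dist_eq_0:
  assumes "pair_graph G" "u \<in> pverts G"
  shows "graph_dist G u v = 0 \<longleftrightarrow> u = v"
proof
  assume "graph_dist G u v = 0"
  then show "u = v"
    using graph_dist_leD[OF pair_graph_fin[OF assms(1)], of u v 0] by (auto simp: zero_ereal_def)
next
  assume "u = v"
  then have "graph_dist G u v \<le> 0"
    using graph_dist_le[OF pair_graph_wf[OF assms(1)] assms(2), of v 0] by (simp add: zero_ereal_def)
  moreover have "0 \<le> graph_dist G u v"
    by (rule le_graph_distI) (use assms pair_graph_fin in auto)
  ultimately show "graph_dist G u v = 0" by simp
qed

lemma graph_dist_arc:
  assumes G: "pair_graph G" and "(u, v) \<in> parcs G" and "s \<in> pverts G"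
  shows "graph_dist G u s \<le> graph_dist G v s + 1"
proof (cases rule: graph_dist_cases[OF pair_graph_fin[OF G], of v s])
  case (2 k)
  have "u \<in> pverts G"
    using assms pair_wf_digraph.in_arcsD1 pair_graph_wf by metis
  moreover have "(u, s) \<in> parcs G ^^ Suc k"
    using assms(2) 2(2) by (rule relpow_Suc_I2)
  ultimately show ?thesis
    using graph_dist_le[OF pair_graph_wf[OF G], of u s "Suc k"] 2(1) by (simp add: add.commute)
qed simp


section \<open>Isometric embeddings\<close>

text \<open>Serves twice: for the copy of a graph inside its host, and for moving the host from
  labels to natural numbers.\<close>

definition map_pgraph :: "('a \<Rightarrow> 'b) \<Rightarrow> 'a pair_pre_digraph \<Rightarrow> 'b pair_pre_digraph" where
  "map_pgraph f G = \<lparr>pverts = f ` pverts G, parcs = map_prod f f ` parcs G\<rparr>"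

lemma map_pgraph_simps [simp]:
  "pverts (map_pgraph f G) = f ` pverts G"
  "parcs (map_pgraph f G) = map_prod f f ` parcs G"
  by (simp_all add: map_pgraph_def)

lemma parcs_subset: "pair_wf_digraph G \<Longrightarrow> parcs G \<subseteq> pverts G \<times> pverts G"
  by (auto dest: pair_wf_digraph.in_arcsD1 pair_wf_digraph.in_arcsD2)

lemma pair_graph_map:
  assumes "pair_graph G" "inj_on f (pverts G)"
  shows "pair_graph (map_pgraph f G)"
proof (rule pair_graphI)
  interpret pair_graph G by fact
  show "finite (pverts (map_pgraph f G))" by simp
  show "parcs (map_pgraph f G) \<subseteq> pverts (map_pgraph f G) \<times> pverts (map_pgraph f G)"
    by (auto dest: wellformed')
  show "sym (parcs (map_pgraph f G))"
    by (rule symI) (auto intro: arcs_symmetric rev_image_eqI)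
  show "irrefl (parcs (map_pgraph f G))"
    using assms(2) by (auto simp: irrefl_def inj_on_def dest: wellformed' no_loops')
qed

lemma relpow_map_pgraph:
  assumes "pair_wf_digraph G" "inj_on f (pverts G)" "u \<in> pverts G" "v \<in> pverts G"
  shows "(f u, f v) \<in> parcs (map_pgraph f G) ^^ k \<longleftrightarrow> (u, v) \<in> parcs G ^^ k"
  using assms(4)
proof (induction k arbitrary: v)
  case 0
  then show ?case using assms(2,3) by (auto dest: inj_onD)
next
  case (Suc k)
  note arcs = pair_wf_digraph.wellformed'[OF assms(1)]
  show ?case
  proof
    assume "(f u, f v) \<in> parcs (map_pgraph f G) ^^ Suc k"
    then obtain x y where "(f u, f x) \<in> parcs (map_pgraph f G) ^^ k" "(x, y) \<in> parcs G" "f v = f y"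
      by auto
    moreover from this have "v = y"
      using assms(2) Suc.prems arcs by (metis inj_onD)
    ultimately show "(u, v) \<in> parcs G ^^ Suc k"
      using Suc.IH arcs by auto
  next
    assume "(u, v) \<in> parcs G ^^ Suc k"
    then obtain x where "(u, x) \<in> parcs G ^^ k" "(x, v) \<in> parcs G"
      by auto
    then show "(f u, f v) \<in> parcs (map_pgraph f G) ^^ Suc k"
      using Suc.IH[of x] arcs by auto
  qed
qed

lemma graph_dist_map:
  assumes "pair_graph G" "inj_on f (pverts G)" "u \<in> pverts G" "v \<in> pverts G"
  shows "graph_dist (map_pgraph f G) (f u) (f v) = graph_dist G u v"
proof -
  note G = assms(1) and G' = pair_graph_map[OF assms(1,2)]
  note walks = relpow_map_pgraph[OF pair_graph_wf[OF G] assms(2-4)]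
  show ?thesis
  proof (rule antisym)
    show "graph_dist (map_pgraph f G) (f u) (f v) \<le> graph_dist G u v"
      using pair_graph_fin[OF G] pair_graph_wf[OF G'] walks assms(3)
      by (intro le_graph_distI graph_dist_le) auto
    show "graph_dist G u v \<le> graph_dist (map_pgraph f G) (f u) (f v)"
      using pair_graph_fin[OF G'] pair_graph_wf[OF G] walks assms(3)
      by (intro le_graph_distI graph_dist_le) auto
  qed
qed

lemma digraph_iso_map:
  assumes "pair_wf_digraph G" "inj_on f (pverts G)"
  shows "digraph_iso (with_proj G) (with_proj (map_pgraph f G))"
proof -
  have "inj_on (map_prod f f) (parcs G)"
    using map_prod_inj_on[OF assms(2,2)] parcs_subset[OF assms(1)] by (rule inj_on_subset)
  then show ?thesis
    using assms unfolding digraph_iso_def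
    \<comment> \<open>Arcs are pairs on both sides, so the arc map is forced by \<open>f\<close>,
      and heads and tails stay the projections.\<close>
    by (intro exI[of _ "\<lparr>iso_verts = f, iso_arcs = map_prod f f, iso_head = snd, iso_tail = fst\<rparr>"])
      (auto simp: pre_digraph.digraph_isomorphism_def app_iso_def with_proj_def wf_digraph_wp_iff[unfolded with_proj_def])
qed

text \<open>Only one inequality between distances has to be checked: arcs go to arcs, so walks of
  \<open>G\<close> persist in \<open>H\<close> and \<open>H\<close> cannot increase distances. The
  copy of \<open>G\<close> is its image under \<open>f\<close>.\<close>

lemma isometric_universalI:
  assumes H: "pair_graph H" and C: "\<And>G. G \<in> C \<Longrightarrow> pair_graph G"
    and emb: "\<And>G. G \<in> C \<Longrightarrow> \<exists>f. inj_on f (pverts G) \<and> f ` pverts G \<subseteq> pverts H \<and>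
      map_prod f f ` parcs G \<subseteq> parcs H \<and>
      (\<forall>u\<in>pverts G. \<forall>v\<in>pverts G. graph_dist G u v \<le> graph_dist H (f u) (f v))"
  shows "isometric_universal H C"
  unfolding isometric_universal_def
proof
  fix G assume "G \<in> C"
  then obtain f where f: "inj_on f (pverts G)" "f ` pverts G \<subseteq> pverts H"
    "map_prod f f ` parcs G \<subseteq> parcs H"
    "\<And>u v. u \<in> pverts G \<Longrightarrow> v \<in> pverts G \<Longrightarrow> graph_dist G u v \<le> graph_dist H (f u) (f v)"
    using emb by meson
  note G = C[OF \<open>G \<in> C\<close>]
  note K = pair_graph_map[OF G f(1)]
  have mono: "parcs (map_pgraph f G) ^^ k \<subseteq> parcs H ^^ k" for k
    using f(3) by (induction k) (auto intro: relcomp_mono)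
  have "graph_dist H (f u) (f v) \<le> graph_dist (map_pgraph f G) (f u) (f v)"
    if "u \<in> pverts G" for u v
    using pair_graph_fin[OF K] pair_graph_wf[OF H] mono f(2) that
    by (intro le_graph_distI graph_dist_le) auto
  then have "graph_dist (map_pgraph f G) (f u) (f v) = graph_dist H (f u) (f v)"
    if "u \<in> pverts G" "v \<in> pverts G" for u v
    using that f(4) graph_dist_map[OF G f(1)] by (metis antisym)
  then have "isometric_subgraph (map_pgraph f G) H"
    using f(2,3) pair_graph_wf[OF K] pair_graph_wf[OF H]
    by (auto simp: isometric_subgraph_def subgraph_def compatible_def wf_digraph_wp_iff)
  then show "\<exists>K. pair_graph K \<and> isometric_subgraph K H \<and> digraph_iso (with_proj G) (with_proj K)"
    using K digraph_iso_map[OF pair_graph_wf[OF G] f(1)] by blast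
qed

text \<open>Needed because the universal graph is built on labels but is wanted on natural
  numbers.\<close>

lemma isometric_universal_map:
  assumes L: "pair_graph L" "isometric_universal L C" "\<And>G. G \<in> C \<Longrightarrow> pair_graph G"
    and inj: "inj_on g (pverts L)"
  shows "isometric_universal (map_pgraph g L) C"
  unfolding isometric_universal_def
proof
  fix G assume "G \<in> C"
  then obtain K where K: "pair_graph K" "isometric_subgraph K L" "digraph_iso (with_proj G) (with_proj K)"
    using L(2) unfolding isometric_universal_def by blast
  then have sub: "pverts K \<subseteq> pverts L" "parcs K \<subseteq> parcs L"
    by (simp_all add: isometric_subgraph_def subgraph_def)
  have injK: "inj_on g (pverts K)"
    using inj sub(1) by (rule inj_on_subset)
  note K' = pair_graph_map[OF K(1) injK]
  have "graph_dist (map_pgraph g K) (g u) (g v) = graph_dist (map_pgraph g L) (g u) (g v)"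
    if "u \<in> pverts K" "v \<in> pverts K" for u v
  proof -
    have "u \<in> pverts L" "v \<in> pverts L"
      using that sub(1) by auto
    then show ?thesis
      using K(2) that graph_dist_map[OF K(1) injK that] graph_dist_map[OF L(1) inj]
      by (simp add: isometric_subgraph_def)
  qed
  then have "isometric_subgraph (map_pgraph g K) (map_pgraph g L)"
    using sub pair_graph_wf[OF K'] pair_graph_wf[OF pair_graph_map[OF L(1) inj]]
    by (auto simp: isometric_subgraph_def subgraph_def compatible_def wf_digraph_wp_iff)
  moreover have "digraph_iso (with_proj G) (with_proj (map_pgraph g K))"
    using K(3) digraph_iso_map[OF pair_graph_wf[OF K(1)] injK] by (rule digraph_iso_trans)
  ultimately show "\<exists>K. pair_graph K \<and> isometric_subgraph K (map_pgraph g L) \<and>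
      digraph_iso (with_proj G) (with_proj K)"
    using K' by blast
qed

text \<open>For \<open>n = 1\<close> the logarithm vanishes and the bound allows a single vertex, so
  this order is settled without labels.\<close>

lemma isometric_universal_order_1:
  assumes "pair_graph H" "card (pverts H) = 1"
    and "\<And>G. G \<in> C \<Longrightarrow> pair_graph G \<and> card (pverts G) = 1"
  shows "isometric_universal H C"
proof (rule isometric_universalI)
  fix G assume "G \<in> C"
  with assms(3) have G: "pair_graph G" "card (pverts G) = 1"
    by auto
  obtain x y where xy: "pverts G = {x}" "pverts H = {y}"
    using G(2) assms(2) by (auto simp: card_1_singleton_iff)
  have "parcs G = {}"
  proof (rule ccontr)
    assume "parcs G \<noteq> {}"
    then obtain a where a: "a \<in> parcs G" by blast
    then have "a = (x, x)"
      using parcs_subset[OF pair_graph_wf[OF G(1)]] xy by auto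
    with a show False
      using pair_graph_irrefl[OF G(1)] by blast
  qed
  moreover have "graph_dist G x x = 0" "graph_dist H y y = 0"
    using graph_dist_eq_0[OF G(1), of x x] graph_dist_eq_0[OF assms(1), of y y] xy by simp_all
  ultimately show "\<exists>f. inj_on f (pverts G) \<and> f ` pverts G \<subseteq> pverts H \<and>
      map_prod f f ` parcs G \<subseteq> parcs H \<and>
      (\<forall>u\<in>pverts G. \<forall>v\<in>pverts G. graph_dist G u v \<le> graph_dist H (f u) (f v))"
    using xy by (intro exI[of _ "\<lambda>_. y"]) auto
qed (use assms in auto)


section \<open>The graph of distance labels\<close>

text \<open>One address is a prefix of the other, that is, one tree node is an ancestor of the other
  or equal to it. Cutting both to the common length keeps the definition symmetric.\<close>

definition comparable :: "'a list \<Rightarrow> 'a list \<Rightarrow> bool" where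
  "comparable p q \<longleftrightarrow> (let m = min (length p) (length q) in take m p = take m q)"

lemma comparable_sym: "comparable p q \<longleftrightarrow> comparable q p"
  unfolding comparable_def Let_def min.commute[of "length p"] by (rule eq_commute)

lemma comparable_Nil [simp]: "comparable [] q" "comparable p []"
  by (simp_all add: comparable_def)

lemma comparable_Cons [simp]: "comparable (x # p) (y # q) \<longleftrightarrow> x = y \<and> comparable p q"
  by (simp add: comparable_def Let_def)

text \<open>Ensures that a position \<open>(l, a)\<close> refers to the same separator vertex in two
  labels at comparable nodes, as long as \<open>l\<close> exceeds neither depth.\<close>

lemma comparable_take_eq:
  assumes "comparable p q" "l \<le> length p" "l \<le> length q"
  shows "take l p = take l q"
proof -
  have "take l (take (min (length p) (length q)) p) = take l (take (min (length p) (length q)) q)"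
    using assms(1) by (simp only: comparable_def Let_def)
  then show ?thesis
    using assms(2,3) by (simp add: min_def split: if_splits)
qed

text \<open>A label \<open>(p, D)\<close> records a node \<open>p\<close> of the binary tree of recursive separators, addressed by
  the path from the root, and the distances \<open>D (l, a)\<close> to the \<open>a\<close>-th vertex of the separator at the
  ancestor of \<open>p\<close> of depth \<open>l\<close>; junk positions carry \<open>\<infinity>\<close>. The labelled vertex itself belongs to the
  separator at \<open>p\<close>, hence the vanishing distance.\<close>

type_synonym label = "bool list \<times> (nat \<times> nat \<Rightarrow> ereal)"

definition labels :: "nat \<Rightarrow> nat \<Rightarrow> nat \<Rightarrow> label set" where
  "labels L F n = {(p, D). length p \<le> L \<and>
     D \<in> ({..L} \<times> {..<F}) \<rightarrow>\<^sub>E insert \<infinity> ((\<lambda>k. ereal (real k)) ` {..<n}) \<and>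
     (\<exists>a<F. D (length p, a) = 0)}"

text \<open>Only depths of common ancestors are compared, where both labels speak of the same
  vertices. As \<infinity> + 1 = \<infinity>, a finite entry is never close to an infinite
  one.\<close>

definition close_labels :: "nat \<Rightarrow> label \<Rightarrow> label \<Rightarrow> bool" where
  "close_labels F x y \<longleftrightarrow> comparable (fst x) (fst y) \<and>
     (\<forall>l a. l \<le> length (fst x) \<longrightarrow> l \<le> length (fst y) \<longrightarrow> a < F \<longrightarrow>
       snd x (l, a) \<le> snd y (l, a) + 1 \<and> snd y (l, a) \<le> snd x (l, a) + 1)"

lemma close_labels_sym: "close_labels F x y \<Longrightarrow> close_labels F y x"
  by (simp add: close_labels_def comparable_sym[of "fst y"])

definition label_graph :: "nat \<Rightarrow> nat \<Rightarrow> nat \<Rightarrow> label pair_pre_digraph" where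
  "label_graph L F n = \<lparr>pverts = labels L F n,
     parcs = {(x, y). x \<in> labels L F n \<and> y \<in> labels L F n \<and> x \<noteq> y \<and> close_labels F x y}\<rparr>"

lemma label_graph_simps [simp]:
  "pverts (label_graph L F n) = labels L F n"
  "(x, y) \<in> parcs (label_graph L F n) \<longleftrightarrow>
    x \<in> labels L F n \<and> y \<in> labels L F n \<and> x \<noteq> y \<and> close_labels F x y"
  by (simp_all add: label_graph_def)

text \<open>There are fewer than \<open>2 ^ Suc L\<close> addresses, and each of the
  \<open>Suc L * F\<close> entries takes one of at most \<open>n + 1\<close> values:
  \<open>n\<close> finite distances and \<infinity>.\<close>

lemma labels_bound:
  "finite (labels L F n)" "card (labels L F n) \<le> 2 ^ Suc L * (n + 1) ^ (Suc L * F)"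
proof -
  let ?P = "{p :: bool list. set p \<subseteq> UNIV \<and> length p \<le> L}"
  let ?V = "insert \<infinity> ((\<lambda>k. ereal (real k)) ` {..<n})"
  let ?D = "({..L} \<times> {..<F}) \<rightarrow>\<^sub>E ?V"
  have sub: "labels L F n \<subseteq> ?P \<times> ?D"
    by (auto simp: labels_def)
  have fin: "finite ?P" "finite ?D"
    by (intro finite_lists_length_le finite_PiE; simp)+
  then show "finite (labels L F n)"
    using sub by (meson finite_SigmaI finite_subset)
  have "card ?P = (\<Sum>i\<le>L. 2 ^ i)"
    by (subst card_lists_length_le) (auto simp: UNIV_bool numeral_2_eq_2)
  also have "\<dots> \<le> 2 ^ Suc L"
    by (induction L) auto
  finally have P: "card ?P \<le> 2 ^ Suc L" .
  have "card ?V \<le> n + 1"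
    by (metis (no_types, lifting) Suc_eq_plus1 card_image_le card_insert_le_m1 card_lessThan
        diff_Suc_1 finite_lessThan zero_less_Suc)
  then have "card ?D \<le> (n + 1) ^ (Suc L * F)"
    by (simp add: card_PiE card_cartesian_product power_mono)
  with P have "card (?P \<times> ?D) \<le> 2 ^ Suc L * (n + 1) ^ (Suc L * F)"
    unfolding card_cartesian_product by (rule mult_le_mono)
  moreover have "card (labels L F n) \<le> card (?P \<times> ?D)"
    using sub fin by (intro card_mono) auto
  ultimately show "card (labels L F n) \<le> 2 ^ Suc L * (n + 1) ^ (Suc L * F)"
    by linarith
qed

lemma pair_graph_label_graph: "pair_graph (label_graph L F n)"
proof (rule pair_graphI)
  show "sym (parcs (label_graph L F n))"
    by (rule symI) (auto dest: close_labels_sym)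
qed (auto simp: labels_bound irrefl_def)

text \<open>Here \<open>(l, a)\<close> is the position of the zero entry of a shallowest label on the walk.\<close>

lemma label_walk:
  assumes "x \<in> labels L F n" "(x, y) \<in> parcs (label_graph L F n) ^^ k"
  obtains l a i j where "i + j = k" "l \<le> length (fst x)" "l \<le> length (fst y)"
    "take l (fst x) = take l (fst y)" "a < F"
    "snd x (l, a) \<le> ereal (real i)" "snd y (l, a) \<le> ereal (real j)"
proof -
  have zero: "\<exists>a<F. snd z (length (fst z), a) = 0" if "z \<in> labels L F n" for z
    using that by (cases z) (simp add: labels_def)
  \<comment> \<open>The last conjunct strengthens the induction: when a shallower label is reached,
    its zero position is a new one, and the entry of \<open>x\<close> there must already be under
    control.\<close>
  have "\<exists>l a i j. i + j = k \<and> l \<le> length (fst x) \<and> l \<le> length (fst y) \<and>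
    take l (fst x) = take l (fst y) \<and> a < F \<and>
    snd x (l, a) \<le> ereal (real i) \<and> snd y (l, a) \<le> ereal (real j) \<and>
    (\<forall>l'\<le>l. \<forall>b<F. snd x (l', b) \<le> snd y (l', b) + ereal (real k))"
    using assms(2)
  proof (induction k arbitrary: y)
    case 0
    then have "y = x"
      by simp
    obtain a where a: "a < F" "snd x (length (fst x), a) = 0"
      using zero[OF assms(1)] by blast
    have le: "snd x (length (fst x), a) \<le> ereal (real 0)"
      using a(2) by simp
    show ?case
      unfolding \<open>y = x\<close>
      by (rule exI[of _ "length (fst x)"], rule exI[of _ a], rule exI[of _ 0], rule exI[of _ 0])
        (use a(1) le in \<open>simp flip: zero_ereal_def\<close>)
  next
    case (Suc k)
    from Suc.prems obtain w where w:
      "(x, w) \<in> parcs (label_graph L F n) ^^ k" "(w, y) \<in> parcs (label_graph L F n)"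
      by (rule relpow_Suc_E)
    from Suc.IH[OF w(1)] obtain l a i j where IH: "i + j = k" "l \<le> length (fst x)"
      "l \<le> length (fst w)" "take l (fst x) = take l (fst w)" "a < F"
      "snd x (l, a) \<le> ereal (real i)" "snd w (l, a) \<le> ereal (real j)"
      "\<forall>l'\<le>l. \<forall>b<F. snd x (l', b) \<le> snd w (l', b) + ereal (real k)"
      by (elim exE conjE) (rule that)
    have y: "y \<in> labels L F n" "comparable (fst w) (fst y)"
      and close: "\<And>l b. l \<le> length (fst w) \<Longrightarrow> l \<le> length (fst y) \<Longrightarrow> b < F \<Longrightarrow>
        snd w (l, b) \<le> snd y (l, b) + 1 \<and> snd y (l, b) \<le> snd w (l, b) + 1"
      using w(2) by (auto simp: close_labels_def)
    have step: "snd x (l', b) \<le> snd y (l', b) + ereal (real (Suc k))"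
      if "l' \<le> l" "l' \<le> length (fst y)" "b < F" for l' b
    proof -
      have "snd x (l', b) \<le> snd w (l', b) + ereal (real k)"
        using IH(8) that by blast
      also have "\<dots> \<le> (snd y (l', b) + 1) + ereal (real k)"
        using close[of l' b] that IH(3) by (intro add_right_mono) auto
      also have "\<dots> = snd y (l', b) + ereal (real (Suc k))"
        by (simp add: add.assoc one_ereal_def)
      finally show ?thesis .
    qed
    show ?case
    proof (cases "l \<le> length (fst y)")
      case True
      \<comment> \<open>The new label is not shallower than \<open>l\<close>: the position is kept
        and the last step is charged to \<open>j\<close>.\<close>
      have "snd y (l, a) \<le> snd w (l, a) + 1"
        using close True IH by blast
      also have "\<dots> \<le> ereal (real j) + 1"
        using IH(7) by (rule add_right_mono)
      finally have "snd y (l, a) \<le> ereal (real (Suc j))"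
        by (simp add: one_ereal_def add.commute)
      moreover have "take l (fst x) = take l (fst y)"
        using IH(3,4) True comparable_take_eq[OF y(2)] by simp
      moreover have "\<forall>l'\<le>l. \<forall>b<F. snd x (l', b) \<le> snd y (l', b) + ereal (real (Suc k))"
        using step True by simp
      moreover have "i + Suc j = Suc k"
        using IH(1) by simp
      ultimately show ?thesis
        using IH(2,5,6) True by blast
    next
      case False
      \<comment> \<open>The new label is strictly shallower: its own zero entry becomes the
        position, with all \<open>Suc k\<close> steps charged to \<open>x\<close> and none to
        \<open>y\<close>.\<close>
      define m where "m = length (fst y)"
      obtain b where b: "b < F" "snd y (m, b) = 0"
        using zero[OF y(1)] by (auto simp: m_def)
      have "take m (fst x) = take m (fst w)"
        using IH(4) False unfolding m_def by (metis min.absorb1 nat_le_linear take_take)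
      also have "\<dots> = take m (fst y)"
        using False IH(3) by (intro comparable_take_eq[OF y(2)]) (auto simp: m_def)
      finally have "take m (fst x) = take m (fst y)" .
      moreover have "snd x (m, b) \<le> ereal (real (Suc k))"
        using step[of m b] b False by (simp add: m_def)
      moreover have "snd y (m, b) \<le> ereal (real 0)"
        using b(2) by simp
      moreover have "\<forall>l'\<le>m. \<forall>b<F. snd x (l', b) \<le> snd y (l', b) + ereal (real (Suc k))"
        using step False by (simp add: m_def)
      moreover have "m \<le> length (fst x)" "m \<le> length (fst y)" "Suc k + 0 = Suc k"
        using False IH(2) by (simp_all add: m_def)
      ultimately show ?thesis
        using b(1) by blast
    qed
  qed
  then show thesis
    by (elim exE conjE) (rule that)
qed


section \<open>Recursive separation\<close>

lemma hereditaryD: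
  assumes "hereditary C" "G \<in> C" "pair_wf_digraph G" "W \<subseteq> pverts G"
  shows "\<lparr>pverts = W, parcs = parcs G \<inter> W \<times> W\<rparr> \<in> C"
proof -
  let ?H = "\<lparr>pverts = W, parcs = parcs G \<inter> W \<times> W\<rparr>"
  have "pair_wf_digraph ?H"
    by unfold_locales auto
  then have "induced_subgraph (with_proj ?H) (with_proj G)"
    using assms(3,4)
    by (auto simp: induced_subgraph_def subgraph_def compatible_def wf_digraph_wp_iff)
  with assms(1,2) show ?thesis
    unfolding hereditary_def by blast
qed

text \<open>The separator of the graph induced on \<open>W\<close> fills the root, and the two sides
  are treated recursively below it. Each descent leaves at most two thirds of the vertices, which
  bounds the depth; no arc joins the two sides, which gives comparability; monotonicity of
  \<open>f\<close> gives one bound for all nodes.\<close>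

lemma separator_tree:
  assumes C: "mono f" "graph_class C" "hereditary C" "has_balanced_separators C f" and "G \<in> C"
    and "W \<subseteq> pverts G"
  shows "\<exists>p idx. (\<forall>v\<in>W. (3 / 2 :: real) ^ length (p v) \<le> real (card W)) \<and>
    (\<forall>v\<in>W. idx v < f (card (pverts G))) \<and> inj_on (\<lambda>v. (p v :: bool list, idx v)) W \<and>
    (\<forall>u\<in>W. \<forall>v\<in>W. (u, v) \<in> parcs G \<longrightarrow> comparable (p u) (p v))"
proof -
  have "pair_graph G"
    using C(2) \<open>G \<in> C\<close> by (simp add: graph_class_def)
  then interpret pair_graph G .
  have "finite W"
    using pair_finite_verts \<open>W \<subseteq> pverts G\<close> finite_subset by blast
  then show ?thesis
    using \<open>W \<subseteq> pverts G\<close>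
  proof (induction W rule: finite_psubset_induct)
    case (psubset W)
    show ?case
    proof (cases "W = {}")
      case True
      then show ?thesis by simp
    next
      case False
      then have pos: "card W \<ge> 1"
        using psubset.hyps by (simp add: Suc_leI card_gt_0_iff)
      let ?H = "\<lparr>pverts = W, parcs = parcs G \<inter> W \<times> W\<rparr>"
      have "?H \<in> graphs_of_order C (card W)"
        using hereditaryD[OF C(3) \<open>G \<in> C\<close> pair_wf_digraph psubset.prems]
        by (simp add: graphs_of_order_def)
      then obtain S where S: "balanced_separator ?H S" "card S \<le> f (card W)"
        using C(4) pos unfolding has_balanced_separators_def by blast
      have SW: "S \<subseteq> W"
        using S(1) by (simp add: balanced_separator_def)
      obtain X Y where XY: "X \<union> Y = W - S" "X \<inter> Y = {}"
        "real (card X) \<le> 2 * real (card W) / 3" "real (card Y) \<le> 2 * real (card W) / 3"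
        "\<And>x y. x \<in> X \<Longrightarrow> y \<in> Y \<Longrightarrow> (x, y) \<notin> parcs G"
      proof -
        obtain X Y where XY: "X \<union> Y = W - S" "X \<inter> Y = {}"
          "real (card X) \<le> 2 * real (card W) / 3" "real (card Y) \<le> 2 * real (card W) / 3"
          and sep: "\<And>x y. x \<in> X \<Longrightarrow> y \<in> Y \<Longrightarrow> (x, y) \<notin> parcs G \<inter> W \<times> W"
          using S(1) unfolding balanced_separator_def by auto
        \<comment> \<open>The separator speaks of arcs inside \<open>W\<close> only, but both sides
          lie in \<open>W\<close>.\<close>
        have "(x, y) \<notin> parcs G" if "x \<in> X" "y \<in> Y" for x y
          using sep[OF that] XY(1) that by blast
        with XY show thesis by (rule that)
      qed
      have "card W \<le> card (pverts G)"
        using psubset.prems pair_finite_verts by (rule card_mono[rotated])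
      then have "card S \<le> f (card (pverts G))"
        using S(2) monoD[OF C(1)] le_trans by blast
      moreover obtain g where g: "bij_betw g S {0..<card S}"
        using ex_bij_betw_finite_nat finite_subset[OF SW psubset.hyps] by blast
      ultimately have g': "g v < f (card (pverts G))" if "v \<in> S" for v
        using bij_betwE[OF g] that by fastforce
      \<comment> \<open>\<open>S\<close> may be empty, so it is the two-thirds bound that makes the
        sides proper subsets of the nonempty \<open>W\<close>.\<close>
      have "X \<noteq> W" "Y \<noteq> W"
        using XY(3,4) pos by auto
      then have "X \<subset> W" and "Y \<subset> W"
        using XY(1) by auto
      have "X \<subseteq> pverts G" and "Y \<subseteq> pverts G"
        using \<open>X \<subset> W\<close> \<open>Y \<subset> W\<close> psubset.prems by auto
      from psubset.IH[OF \<open>X \<subset> W\<close> \<open>X \<subseteq> pverts G\<close>] obtain pX iX where X: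
        "\<forall>v\<in>X. (3 / 2 :: real) ^ length (pX v) \<le> real (card X)"
        "\<forall>v\<in>X. iX v < f (card (pverts G))" "inj_on (\<lambda>v. (pX v :: bool list, iX v)) X"
        "\<forall>u\<in>X. \<forall>v\<in>X. (u, v) \<in> parcs G \<longrightarrow> comparable (pX u) (pX v)"
        by (elim exE conjE) (rule that)
      from psubset.IH[OF \<open>Y \<subset> W\<close> \<open>Y \<subseteq> pverts G\<close>] obtain pY iY where Y:
        "\<forall>v\<in>Y. (3 / 2 :: real) ^ length (pY v) \<le> real (card Y)"
        "\<forall>v\<in>Y. iY v < f (card (pverts G))" "inj_on (\<lambda>v. (pY v :: bool list, iY v)) Y"
        "\<forall>u\<in>Y. \<forall>v\<in>Y. (u, v) \<in> parcs G \<longrightarrow> comparable (pY u) (pY v)"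
        by (elim exE conjE) (rule that)
      define p where "p v = (if v \<in> S then [] else if v \<in> X then False # pX v else True # pY v)" for v
      define idx where "idx v = (if v \<in> S then g v else if v \<in> X then iX v else iY v)" for v
      have cases: "v \<in> S \<or> v \<in> X \<and> v \<notin> S \<and> v \<notin> Y \<or> v \<in> Y \<and> v \<notin> S \<and> v \<notin> X" if "v \<in> W" for v
        using that XY(1,2) by blast
      have "(3 / 2 :: real) ^ length (p v) \<le> real (card W)" if "v \<in> W" for v
        using cases[OF that] X(1) Y(1) XY(3,4) pos by (auto simp: p_def)
      moreover have "idx v < f (card (pverts G))" if "v \<in> W" for v
        using cases[OF that] X(2) Y(2) g'[of v] by (auto simp: idx_def)
      moreover have "inj_on (\<lambda>v. (p v, idx v)) W"
      proof (rule inj_onI)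
        fix u v assume uv: "u \<in> W" "v \<in> W" "(p u, idx u) = (p v, idx v)"
        then show "u = v"
          using cases[OF uv(1)] cases[OF uv(2)] inj_onD[OF X(3), of u v] inj_onD[OF Y(3), of u v]
            inj_onD[OF bij_betw_imp_inj_on[OF g], of u v]
          by (auto simp: p_def idx_def)
      qed
      \<comment> \<open>Vertices of \<open>S\<close> have the empty address, comparable to all.
        Separation excludes arcs from \<open>X\<close> to \<open>Y\<close>; symmetry of the arcs
        excludes the other direction.\<close>
      moreover have "comparable (p u) (p v)" if "u \<in> W" "v \<in> W" "(u, v) \<in> parcs G" for u v
        using cases[OF that(1)] cases[OF that(2)] X(4) Y(4) that(3)
          XY(5)[of u v] XY(5)[of v u] arcs_symmetric[OF that(3)]
        by (auto simp: p_def)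
      ultimately show ?thesis
        by (intro exI[of _ p] exI[of _ idx] conjI ballI impI)
    qed
  qed
qed


section \<open>Embedding graphs into the label graph\<close>

text \<open>A vertex is sent to its node and its distance vector. Entries change by at most one
  along an arc, so arcs are kept; a walk between two labels yields a separator vertex
  \<open>s\<close> through which the triangle inequality bounds the distance in
  \<open>G\<close>.\<close>

lemma embed_label_graph:
  fixes G :: "'a pair_pre_digraph" and p :: "'a \<Rightarrow> bool list"
  assumes G: "pair_graph G" "card (pverts G) = n"
    and len: "\<And>v. v \<in> pverts G \<Longrightarrow> length (p v) \<le> L"
    and idx: "\<And>v. v \<in> pverts G \<Longrightarrow> idx v < F"
    and inj: "inj_on (\<lambda>v. (p v, idx v)) (pverts G)"
    and comp: "\<And>u v. (u, v) \<in> parcs G \<Longrightarrow> comparable (p u) (p v)"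
  shows "\<exists>\<phi>. inj_on \<phi> (pverts G) \<and> \<phi> ` pverts G \<subseteq> pverts (label_graph L F n) \<and>
    map_prod \<phi> \<phi> ` parcs G \<subseteq> parcs (label_graph L F n) \<and>
    (\<forall>u\<in>pverts G. \<forall>v\<in>pverts G.
      graph_dist G u v \<le> graph_dist (label_graph L F n) (\<phi> u) (\<phi> v))"
proof -
  define anc where "anc q a = {s \<in> pverts G. p s = q \<and> idx s = a}" for q a
  \<comment> \<open>By injectivity of the addresses \<open>anc\<close> has at most one element, so
    the infimum is the distance to it, or \<infinity> at a position that no vertex occupies.\<close>
  define D where "D v = (\<lambda>(l, a)\<in>{..L} \<times> {..<F}.
    if l \<le> length (p v) then INF s\<in>anc (take l (p v)) a. graph_dist G v s else \<infinity>)" for v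
  define \<phi> where "\<phi> v = (p v, D v)" for v
  have anc: "anc q a = {} \<or> (\<exists>s\<in>pverts G. anc q a = {s} \<and> p s = q \<and> idx s = a)" for q a
  proof (cases "anc q a = {}")
    case False
    then obtain s where s: "s \<in> pverts G" "p s = q" "idx s = a"
      by (auto simp: anc_def)
    then have "anc q a = {s}"
      using inj by (auto simp: anc_def dest: inj_onD)
    with s show ?thesis by blast
  qed simp
  have anc_self: "anc (p v) (idx v) = {v}" if "v \<in> pverts G" for v
  proof -
    have "v \<in> anc (p v) (idx v)"
      using that by (simp add: anc_def)
    moreover from this obtain s where "anc (p v) (idx v) = {s}"
      using anc[of "p v" "idx v"] by blast
    ultimately show ?thesis
      by simp
  qed
  have D: "D v (l, a) = (INF s\<in>anc (take l (p v)) a. graph_dist G v s)"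
    if "v \<in> pverts G" "l \<le> length (p v)" "a < F" for v l a
    using that len[OF that(1)] by (simp add: D_def)
  \<comment> \<open>Among vertices of the same node only \<open>u\<close> has a zero at the position
    of \<open>u\<close>. This gives injectivity and also the zero entry that a label must
    have.\<close>
  have zero: "D v (length (p u), idx u) = 0 \<longleftrightarrow> v = u"
    if "u \<in> pverts G" "v \<in> pverts G" "p v = p u" for u v
    using D[of v "length (p v)" "idx u"] that idx anc_self graph_dist_eq_0[OF G(1)] by simp
  have injphi: "inj_on \<phi> (pverts G)"
    by (rule inj_onI) (metis \<phi>_def prod.inject zero)
  have verts: "\<phi> v \<in> labels L F n" if v: "v \<in> pverts G" for v
  proof -
    have dist: "graph_dist G v s \<in> insert \<infinity> ((\<lambda>k. ereal (real k)) ` {..<n})" for s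
      using G by (cases rule: graph_dist_cases[OF pair_graph_fin[OF G(1)], of v s]) auto
    have "(INF s\<in>anc q a. graph_dist G v s) \<in> insert \<infinity> ((\<lambda>k. ereal (real k)) ` {..<n})" for q a
    proof (cases "anc q a = {}")
      case False
      then obtain s where "anc q a = {s}"
        using anc by blast
      with dist[of s] show ?thesis by simp
    qed (simp add: top_ereal_def)
    then have "D v \<in> ({..L} \<times> {..<F}) \<rightarrow>\<^sub>E insert \<infinity> ((\<lambda>k. ereal (real k)) ` {..<n})"
      unfolding D_def by (intro restrict_PiE_iff[THEN iffD2]) auto
    then show ?thesis
      using zero[OF v v] idx[OF v] len[OF v] by (auto simp: \<phi>_def labels_def)
  qed
  have close: "D u (l, a) \<le> D v (l, a) + 1"
    if uv: "(u, v) \<in> parcs G" and l: "l \<le> length (p u)" "l \<le> length (p v)" "a < F" for u v l a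
  proof -
    have "u \<in> pverts G" "v \<in> pverts G"
      using uv parcs_subset[OF pair_graph_wf[OF G(1)]] by auto
    moreover have "take l (p u) = take l (p v)"
      using comparable_take_eq[OF comp[OF uv] l(1,2)] .
    ultimately show ?thesis
      using D[of u l a] D[of v l a] l anc[of "take l (p u)" a] graph_dist_arc[OF G(1) uv]
      by (auto simp: top_ereal_def)
  qed
  have arcs: "(\<phi> u, \<phi> v) \<in> parcs (label_graph L F n)" if uv: "(u, v) \<in> parcs G" for u v
  proof -
    have vu: "(v, u) \<in> parcs G"
      using uv pair_graph_sym[OF G(1)] by (blast dest: symD)
    have "u \<in> pverts G" "v \<in> pverts G"
      using uv parcs_subset[OF pair_graph_wf[OF G(1)]] by auto
    moreover have "u \<noteq> v"
      using pair_graph_irrefl[OF G(1) uv] .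
    moreover from calculation have "\<phi> u \<noteq> \<phi> v"
      using inj_onD[OF injphi, of u v] by blast
    moreover have "close_labels F (\<phi> u) (\<phi> v)"
      using comp[OF uv] close[OF uv] close[OF vu] by (simp add: close_labels_def \<phi>_def)
    ultimately show ?thesis
      using verts by simp
  qed
  have "graph_dist G u v \<le> graph_dist (label_graph L F n) (\<phi> u) (\<phi> v)"
    if uv: "u \<in> pverts G" "v \<in> pverts G" for u v
  proof (rule le_graph_distI[OF pair_graph_fin[OF pair_graph_label_graph]])
    fix k assume walk: "(\<phi> u, \<phi> v) \<in> parcs (label_graph L F n) ^^ k"
    obtain l a i j where *: "i + j = k" "l \<le> length (p u)" "l \<le> length (p v)"
      "take l (p u) = take l (p v)" "a < F" "D u (l, a) \<le> ereal (real i)" "D v (l, a) \<le> ereal (real j)"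
      using label_walk[OF verts[OF uv(1)] walk] unfolding \<phi>_def fst_conv snd_conv .
    \<comment> \<open>The entries at the position found are finite, so an actual vertex of
      \<open>G\<close> stands there.\<close>
    then have "anc (take l (p u)) a \<noteq> {}"
      using D[OF uv(1)] by (auto simp: top_ereal_def)
    then obtain s where "s \<in> pverts G" "anc (take l (p u)) a = {s}"
      using anc by blast
    then have "graph_dist G u s \<le> ereal (real i)" "graph_dist G s v \<le> ereal (real j)"
      using * D[OF uv(1), of l a] D[OF uv(2), of l a] graph_dist_sym[OF G(1), of s v] uv by auto
    then show "graph_dist G u v \<le> ereal (real k)"
      using graph_dist_triangle[OF pair_graph_fin[OF G(1)] uv(1)] *(1) by blast
  qed
  with injphi verts arcs show ?thesis
    by (intro exI[of _ \<phi>]) auto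
qed

lemma universal_label_graph:
  assumes C: "mono f" "graph_class C" "hereditary C" "has_balanced_separators C f"
    and L: "\<And>k. (3 / 2 :: real) ^ k \<le> real n \<Longrightarrow> k \<le> L"
  shows "isometric_universal (label_graph L (f n) n) (graphs_of_order C n)"
proof (rule isometric_universalI[OF pair_graph_label_graph])
  fix G assume G: "G \<in> graphs_of_order C n"
  then show "pair_graph G"
    using C(2) by (simp add: graph_class_def graphs_of_order_def)
  have n: "card (pverts G) = n" and "G \<in> C"
    using G by (auto simp: graphs_of_order_def)
  from separator_tree[OF C this(2) order_refl]
  obtain p :: "nat \<Rightarrow> bool list" and idx where *:
    "\<And>v. v \<in> pverts G \<Longrightarrow> (3 / 2 :: real) ^ length (p v) \<le> real n"
    "\<And>v. v \<in> pverts G \<Longrightarrow> idx v < f n" "inj_on (\<lambda>v. (p v, idx v)) (pverts G)"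
    "\<And>u v. u \<in> pverts G \<Longrightarrow> v \<in> pverts G \<Longrightarrow> (u, v) \<in> parcs G \<Longrightarrow> comparable (p u) (p v)"
    unfolding n by blast
  have "comparable (p u) (p v)" if "(u, v) \<in> parcs G" for u v
    using *(4) that parcs_subset[OF pair_graph_wf[OF \<open>pair_graph G\<close>]] by blast
  then show "\<exists>\<phi>. inj_on \<phi> (pverts G) \<and> \<phi> ` pverts G \<subseteq> pverts (label_graph L (f n) n) \<and>
      map_prod \<phi> \<phi> ` parcs G \<subseteq> parcs (label_graph L (f n) n) \<and>
      (\<forall>u\<in>pverts G. \<forall>v\<in>pverts G.
        graph_dist G u v \<le> graph_dist (label_graph L (f n) n) (\<phi> u) (\<phi> v))"
    using embed_label_graph[OF \<open>pair_graph G\<close> n, of p L idx "f n"] L *(1-3) by blast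
qed


section \<open>Counting labels\<close>

text \<open>Squaring turns \<open>3 / 2\<close> into a base that is at least \<open>2\<close>.\<close>

lemma depth_bound:
  assumes "(3 / 2 :: real) ^ k \<le> real n"
  shows "k \<le> nat \<lfloor>2 * log 2 (real n)\<rfloor>"
proof -
  have "0 < (3 / 2 :: real) ^ k"
    by simp
  with assms have "0 < real n"
    by (rule less_le_trans[rotated])
  then have "n > 0"
    by simp
  have "(2 :: real) ^ k \<le> ((3 / 2)\<^sup>2) ^ k"
    by (rule power_mono) (simp_all add: power2_eq_square)
  also have "\<dots> = ((3 / 2) ^ k)\<^sup>2"
    by (simp only: power_mult[symmetric] mult.commute)
  also have "\<dots> \<le> (real n)\<^sup>2"
    using assms by (intro power_mono) auto
  finally have "real k \<le> log 2 ((real n)\<^sup>2)"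
    using \<open>n > 0\<close> by (simp add: le_log_iff powr_realpow)
  also have "\<dots> = 2 * log 2 (real n)"
    using \<open>n > 0\<close> by (simp add: log_nat_power)
  finally show ?thesis
    by linarith
qed

text \<open>With \<open>x = log 2 n\<close> the depth satisfies \<open>Suc L \<le> 3 * x\<close>,
  and \<open>n + 1 \<le> 2 * n \<le> n ^ 2 = 2 powr (2 * x)\<close>. The exponent is thus at most
  \<open>3 * x + 6 * x ^ 2 * F\<close>, which yields the constant 9.\<close>

lemma card_labels_le_powr:
  assumes "n \<ge> 2" "F \<ge> 1"
  shows "real (card (labels (nat \<lfloor>2 * log 2 (real n)\<rfloor>) F n)) \<le> 2 powr (9 * real F * (log 2 (real n))\<^sup>2)"
proof -
  define L where "L = nat \<lfloor>2 * log 2 (real n)\<rfloor>"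
  define x where "x = log 2 (real n)"
  have x: "x \<ge> 1"
    using assms(1) by (simp add: x_def)
  have n: "real n = 2 powr x"
    using assms(1) by (simp add: x_def)
  have L: "real (Suc L) \<le> 3 * x"
    using x unfolding L_def x_def by linarith
  have "n + 1 \<le> n ^ 2"
    using mult_le_mono1[OF assms(1), of n] assms(1) unfolding power2_eq_square by linarith
  then have "real (n + 1) \<le> real n ^ 2"
    by (metis of_nat_le_iff of_nat_power)
  also have "\<dots> = 2 powr (2 * x)"
    by (simp add: n powr_realpow[symmetric] powr_powr mult.commute)
  finally have n1: "real (n + 1) \<le> 2 powr (2 * x)" .
  have "real (card (labels L F n)) \<le> real (2 ^ Suc L * (n + 1) ^ (Suc L * F))"
    using labels_bound(2) by (simp only: of_nat_le_iff)
  also have "\<dots> = 2 ^ Suc L * real (n + 1) ^ (Suc L * F)"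
    by simp
  also have "\<dots> \<le> 2 ^ Suc L * (2 powr (2 * x)) ^ (Suc L * F)"
    using n1 by (intro mult_left_mono power_mono) auto
  also have "\<dots> = 2 powr (real (Suc L) + 2 * x * (real (Suc L) * real F))"
    by (simp only: powr_add powr_realpow[symmetric] powr_powr of_nat_mult zero_less_numeral powr_gt_zero)
  also have "\<dots> \<le> 2 powr (9 * real F * x\<^sup>2)"
  proof (rule powr_mono)
    have "real (Suc L) + 2 * x * (real (Suc L) * real F) \<le> 3 * x + 2 * x * (3 * x * real F)"
      using L x by (intro add_mono mult_left_mono mult_right_mono) auto
    \<comment> \<open>Lets the linear term \<open>3 * x\<close> be absorbed into
      \<open>3 * x ^ 2 * F\<close>.\<close>
    moreover have "1 * 1 \<le> x * real F"
      using x assms(2) by (intro mult_mono) auto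
    then have "3 * x * 1 \<le> 3 * x * (x * real F)"
      using x by (intro mult_left_mono) auto
    ultimately show "real (Suc L) + 2 * x * (real (Suc L) * real F) \<le> 9 * real F * x\<^sup>2"
      by (simp add: power2_eq_square algebra_simps)
  qed simp
  finally show ?thesis
    by (simp add: L_def x_def)
qed

text \<open>Heredity provides a one-vertex graph in the class. The empty set does not separate it,
  since the side with the vertex would have size 1 > 2/3; hence \<open>f 1 \<ge> 1\<close>, and
  monotonicity does the rest.\<close>

lemma separator_size_pos:
  assumes "mono f" "graph_class C" "hereditary C" "has_balanced_separators C f"
    and "G \<in> graphs_of_order C n" "n \<ge> 1"
  shows "f n \<ge> 1"
proof -
  have G: "G \<in> C" "card (pverts G) = n"
    using assms(5) by (auto simp: graphs_of_order_def)
  then have "pair_wf_digraph G"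
    using assms(2) by (simp add: graph_class_def pair_graph_wf)
  moreover obtain v where "v \<in> pverts G"
    using G(2) assms(6) by fastforce
  ultimately have "\<lparr>pverts = {v}, parcs = parcs G \<inter> {v} \<times> {v}\<rparr> \<in> C" (is "?H \<in> C")
    by (intro hereditaryD[OF assms(3) G(1)]) simp_all
  then have "?H \<in> graphs_of_order C 1"
    by (simp add: graphs_of_order_def)
  then obtain S where S: "balanced_separator ?H S" "card S \<le> f 1"
    using assms(4) unfolding has_balanced_separators_def by blast
  have "S \<noteq> {}"
  proof
    assume "S = {}"
    with S(1) obtain X Y where XY: "X \<union> Y = {v}" "real (card X) \<le> 2 / 3" "real (card Y) \<le> 2 / 3"
      by (auto simp: balanced_separator_def)
    then have "finite X" "finite Y" "card X = 0" "card Y = 0"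
      by (auto intro: finite_subset[of _ "{v}"])
    with XY(1) show False by simp
  qed
  then have "card S \<ge> 1"
    using S(1) finite_subset[of S "{v}"] by (auto simp: balanced_separator_def Suc_le_eq card_gt_0_iff)
  with S(2) show ?thesis
    using monoD[OF assms(1,6)] by linarith
qed

text \<open>The constant is chosen before \<open>f\<close>, \<open>C\<close> and \<open>n\<close>,
  so the factor hidden in the O-notation is absolute.\<close>

theorem theorem3p4:
  shows "\<exists>c::real. c > 0 \<and>
    (\<forall>(f :: nat \<Rightarrow> nat) (C :: ngraph set).
       mono f \<longrightarrow> graph_class C \<longrightarrow> hereditary C \<longrightarrow> has_balanced_separators C f \<longrightarrow>
       (\<forall>n\<ge>1. \<exists>H :: ngraph. pair_graph H \<and>
          isometric_universal H (graphs_of_order C n) \<and>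
          real (card (pverts H)) \<le> 2 powr (c * real (f n) * (log 2 (real n))\<^sup>2)))"
proof (intro exI[of _ 9] conjI allI impI)
  fix f :: "nat \<Rightarrow> nat" and C :: "ngraph set" and n :: nat
  assume C: "mono f" "graph_class C" "hereditary C" "has_balanced_separators C f" and n: "n \<ge> 1"
  let ?C = "graphs_of_order C n"
  have graphs: "pair_graph G" "card (pverts G) = n" if "G \<in> ?C" for G
    using that C(2) by (auto simp: graph_class_def graphs_of_order_def)
  \<comment> \<open>If no graph has order \<open>n\<close>, then \<open>f n\<close> may be 0 and the
    count of labels does not apply, but the empty graph suffices. For \<open>n = 1\<close> the bound
    equals 1 and any member is universal.\<close>
  consider "?C = {}" | G where "G \<in> ?C" "n = 1" | G where "G \<in> ?C" "n \<ge> 2"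
    using n by fastforce
  then show "\<exists>H :: ngraph. pair_graph H \<and> isometric_universal H ?C \<and>
    real (card (pverts H)) \<le> 2 powr (9 * real (f n) * (log 2 (real n))\<^sup>2)"
  proof cases
    case 1
    have "pair_graph (\<lparr>pverts = {}, parcs = {}\<rparr> :: ngraph)"
      by (rule pair_graphI) (auto simp: sym_def irrefl_def)
    with 1 show ?thesis
      by (intro exI[of _ "\<lparr>pverts = {}, parcs = {}\<rparr>"]) (simp add: isometric_universal_def)
  next
    case 2
    then show ?thesis
      using graphs by (intro exI[of _ G]) (auto intro: isometric_universal_order_1)
  next
    case 3
    define L where "L = label_graph (nat \<lfloor>2 * log 2 (real n)\<rfloor>) (f n) n"
    have L: "pair_graph L" "isometric_universal L ?C"
      unfolding L_def using universal_label_graph[OF C depth_bound] pair_graph_label_graph by auto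
    have "finite (pverts L)"
      by (simp add: L_def labels_bound)
    then obtain g :: "label \<Rightarrow> nat" where g: "inj_on g (pverts L)"
      using finite_imp_inj_to_nat_seg by blast
    have "card (pverts (map_pgraph g L)) = card (pverts L)"
      using card_image[OF g] by simp
    then have "real (card (pverts (map_pgraph g L))) \<le> 2 powr (9 * real (f n) * (log 2 (real n))\<^sup>2)"
      using card_labels_le_powr[OF 3(2) separator_size_pos[OF C 3(1) n]] by (simp add: L_def)
    then show ?thesis
      using pair_graph_map[OF L(1) g] isometric_universal_map[OF L graphs(1) g] by blast
  qed
qed simp

end
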